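(* Let $n=n_1+n_2+n_3$, let $\mathcal J,\mathcal R\in\mathbb R^{n\times n}$, $\mathcal B\in\mathbb R^{n\times m}$, $\mathcal E\in\mathbb R^{n_2\times n_2}$, $e\in C(\mathbb R^{n_1}\times\mathbb R^{n_2},\mathbb R^{n_2})$ with $\mathcal J=-\mathcal J^\top$ and $\mathcal R=\mathcal R^\top$ positive semi-definite. Let the Hamiltonian be of the quadratic form $$\mathcal H(z_1,z_2)=\tfrac12\langle z_1,\mathcal M_1z_1\rangle+\tfrac12\langle z_2,\mathcal M_2z_2\rangle$$ with symmetric matrices $\mathcal M_1\in\mathbb R^{n_1\times n_1}$, $\mathcal M_2\in\mathbb R^{n_2\times n_2}$, and assume $\mathcal E^\top e(z_1,z_2)=\nabla_{z_2}\mathcal H(z_1,z_2)$ for all $(z_1,z_2)$. Let $\tau>0$ and let $z^k=(z_1^k,z_2^k,z_3^k)$, $k=0,1,2,\dots$, together with $y^{k+1/2}$, be given by the implicit midpoint scheme with step size $\tau$ (defined in the context) applied to $$\begin{bmatrix}\nabla_{z_1}\mathcal H(z_1,z_2)\\ \mathcal E\frac{\mathrm d}{\mathrm dt}z_2\\ 0\end{bmatrix}=(\mathcal J-\mathcal R)\begin{bmatrix}\frac{\mathrm d}{\mathrm dt}z_1\\ e(z_1,z_2)\\ z_3\end{bmatrix}+\mathcal B u,\qquad y=\mathcal B^\top\begin{bmatrix}\frac{\mathrm d}{\mathrm dt}z_1\\ e(z_1,z_2)\\ z_3\end{bmatrix}.$$ Then, with the discrete energy $\mathcal H^k:=\mathcal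 H(z_1^k,z_2^k)$, $$\mathcal H^{k+1}-\mathcal H^k\le\tau\,\langle y^{k+1/2},u^{k+1/2}\rangle .$$ In particular, $\mathcal H^{k+1}\le\mathcal H^k$ for $u=0$.
   Context: $\langle\cdot,\cdot\rangle$ is the Euclidean inner product. Time points are $t_k=k\tau$; $x^k$ denotes the approximation of a variable $x$ at $t_k$; for the state variables $x^{k+1/2}:=\tfrac12(x^k+x^{k+1})$, while $u^{k+1/2}:=u(t_k+\tau/2)$ for the input $u$. The midpoint scheme reads $$\begin{bmatrix}\tau\,\nabla_{z_1}\mathcal H(z_1^{k+1/2},z_2^{k+1/2})\\ \mathcal E(z_2^{k+1}-z_2^k)\\ 0\end{bmatrix}=(\mathcal J-\mathcal R)\begin{bmatrix}z_1^{k+1}-z_1^k\\ \tau\, e(z_1^{k+1/2},z_2^{k+1/2})\\ \tau\, z_3^{k+1/2}\end{bmatrix}+\tau\mathcal B u^{k+1/2},$$ $$\tau y^{k+1/2}=\mathcal B^\top\begin{bmatrix}z_1^{k+1}-z_1^k\\ \tau\, e(z_1^{k+1/2},z_2^{k+1/2})\\ \tau\, z_3^{k+1/2}\end{bmatrix}.$$ *)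

theory Defs
  imports "HOL-Analysis.Abstract_Euclidean_Space" "HOL-Analysis.Derivative"
    "Jordan_Normal_Form.Matrix"
begin

text \<open>
  Elements of R^n are the vectors in \<open>carrier_vec n\<close> of Jordan_Normal_Form, so that all
  dimensions are plain natural numbers. In particular each of the blocks may be empty.
\<close>

no_notation inner (infix \<open>\<bullet>\<close> 70)
no_notation vec_nth (infixl \<open>$\<close> 90)

text \<open>
  The type of vectors carries no topology; the usual one on R^n is pulled back from
  \<^term>\<open>Euclidean_space n\<close>, whose points are the sequences vanishing from index n on.
\<close>

definition vec_topology :: "nat \<Rightarrow> real vec topology" where
  "vec_topology n =
     pullback_topology (carrier_vec n) (\<lambda>v i. if i < n then v $ i else 0) (Euclidean_space n)"

lemma topspace_vec_topology: "topspace (vec_topology n) = carrier_vec n"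
  by (auto simp: vec_topology_def topspace_pullback_topology topspace_Euclidean_space)

text \<open>
  The library's \<open>GDERIV\<close> needs an inner product space type, which these vectors do not form;
  the gradient is therefore the column of partial derivatives.
\<close>

definition grad :: "nat \<Rightarrow> (real vec \<Rightarrow> real) \<Rightarrow> real vec \<Rightarrow> real vec" where
  "grad n f x = Matrix.vec n (\<lambda>i. deriv (\<lambda>t. f (x + t \<cdot>\<^sub>v unit_vec n i)) 0)"

definition positive_semidefinite :: "nat \<Rightarrow> real mat \<Rightarrow> bool" where
  "positive_semidefinite n A \<longleftrightarrow> (\<forall>x \<in> carrier_vec n. 0 \<le> x \<bullet> (A *\<^sub>v x))"

definition midpoint :: "(nat \<Rightarrow> real vec) \<Rightarrow> nat \<Rightarrow> real vec" where
  "midpoint x k = (1 / 2) \<cdot>\<^sub>v (x k + x (Suc k))"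

text \<open>
  The input is sampled at the time \<open>k\<tau> + \<tau>/2\<close>, and is not averaged like the state variables.
\<close>

definition input_mid :: "real \<Rightarrow> (real \<Rightarrow> real vec) \<Rightarrow> nat \<Rightarrow> real vec" where
  "input_mid \<tau> u k = u (real k * \<tau> + \<tau> / 2)"

text \<open>
  The sequences z1, z2, z3 and y satisfy the implicit midpoint scheme with step size \<open>\<tau>\<close> in
  every step; \<open>y k\<close> is the output at the midpoint of the k-th step.
\<close>

definition midpoint_scheme ::
  "nat \<Rightarrow> nat \<Rightarrow> nat \<Rightarrow> nat \<Rightarrow> real mat \<Rightarrow> real mat \<Rightarrow> real mat \<Rightarrow> real mat \<Rightarrow>
   (real vec \<Rightarrow> real vec \<Rightarrow> real vec) \<Rightarrow> (real vec \<Rightarrow> real vec \<Rightarrow> real) \<Rightarrow>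
   real \<Rightarrow> (real \<Rightarrow> real vec) \<Rightarrow>
   (nat \<Rightarrow> real vec) \<Rightarrow> (nat \<Rightarrow> real vec) \<Rightarrow> (nat \<Rightarrow> real vec) \<Rightarrow> (nat \<Rightarrow> real vec) \<Rightarrow> bool" where
  "midpoint_scheme n1 n2 n3 m J R B E e H \<tau> u z1 z2 z3 y \<longleftrightarrow>
    (\<forall>k. z1 k \<in> carrier_vec n1 \<and> z2 k \<in> carrier_vec n2 \<and> z3 k \<in> carrier_vec n3 \<and>
         y k \<in> carrier_vec m) \<and>
    (\<forall>k. let w = (z1 (Suc k) - z1 k) @\<^sub>v (\<tau> \<cdot>\<^sub>v e (midpoint z1 k) (midpoint z2 k))
                   @\<^sub>v (\<tau> \<cdot>\<^sub>v midpoint z3 k)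
         in (\<tau> \<cdot>\<^sub>v grad n1 (\<lambda>x. H x (midpoint z2 k)) (midpoint z1 k))
              @\<^sub>v (E *\<^sub>v (z2 (Suc k) - z2 k)) @\<^sub>v 0\<^sub>v n3
            = (J - R) *\<^sub>v w + \<tau> \<cdot>\<^sub>v (B *\<^sub>v input_mid \<tau> u k) \<and>
            \<tau> \<cdot>\<^sub>v y k = B\<^sup>T *\<^sub>v w)"

end

(*
  Test the scheme with the vector w of discrete flows and efforts: skew-symmetry removes the
  J-term and semi-definiteness gives the R-term a sign, while E^T e = grad_{z2} H turns the
  remaining terms into the pairing of the increments of z1, z2 with the gradient of H at the
  midpoint. For a quadratic H this pairing is exactly the increment of H, by the identity
  <b - a, M (a + b)> = <b, M b> - <a, M a>.
*)

theory Submission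
  imports Defs
begin

lemma symmetric_scalar_prod_mult_mat_vec:
  fixes M :: "real mat"
  assumes M: "M \<in> carrier_mat n n" and sym: "M = M\<^sup>T"
    and x: "x \<in> carrier_vec n" and y: "y \<in> carrier_vec n"
  shows "x \<bullet> (M *\<^sub>v y) = y \<bullet> (M *\<^sub>v x)"
proof -
  have "x \<bullet> (M *\<^sub>v y) = (M\<^sup>T *\<^sub>v x) \<bullet> y"
    using transpose_vec_mult_scalar[OF M y x] by simp
  also have "\<dots> = y \<bullet> (M *\<^sub>v x)"
    unfolding sym[symmetric] using M x y by (intro comm_scalar_prod[of _ n]) auto
  finally show ?thesis .
qed

text \<open>Transposition moves \<open>J\<close> to the other argument and skew-symmetry returns it
  with a minus sign, so the number equals its own negative.\<close>

lemma skew_symmetric_scalar_prod_mult_mat_vec: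
  fixes J :: "real mat"
  assumes J: "J \<in> carrier_mat n n" and skew: "J = - J\<^sup>T" and x: "x \<in> carrier_vec n"
  shows "x \<bullet> (J *\<^sub>v x) = 0"
proof -
  have JT: "J\<^sup>T \<in> carrier_mat n n" using J by simp
  have "J *\<^sub>v x = (- J\<^sup>T) *\<^sub>v x"
    by (subst skew) (rule refl)
  also have "\<dots> = - (J\<^sup>T *\<^sub>v x)"
    using x JT by (intro uminus_mult_mat_vec) auto
  finally have "J *\<^sub>v x = - (J\<^sup>T *\<^sub>v x)" .
  hence "x \<bullet> (J *\<^sub>v x) = - (x \<bullet> (J\<^sup>T *\<^sub>v x))"
    using x JT by simp
  also have "x \<bullet> (J\<^sup>T *\<^sub>v x) = (J\<^sup>T *\<^sub>v x) \<bullet> x"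
    using x JT by (intro comm_scalar_prod[of _ n]) auto
  also have "\<dots> = x \<bullet> (J *\<^sub>v x)"
    by (rule transpose_vec_mult_scalar[OF J x x])
  finally show ?thesis by simp
qed

text \<open>Symmetry merges the two cross terms into one. The expansion is exact, so along every
  line the form is a polynomial in \<open>t\<close> whose linear coefficient gives the directional
  derivative.\<close>

lemma quadratic_form_add_smult:
  fixes M :: "real mat"
  assumes M: "M \<in> carrier_mat n n" and sym: "M = M\<^sup>T"
    and x: "x \<in> carrier_vec n" and v: "v \<in> carrier_vec n"
  shows "(x + t \<cdot>\<^sub>v v) \<bullet> (M *\<^sub>v (x + t \<cdot>\<^sub>v v))
    = x \<bullet> (M *\<^sub>v x) + 2 * t * (v \<bullet> (M *\<^sub>v x)) + t\<^sup>2 * (v \<bullet> (M *\<^sub>v v))"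
proof -
  have c: "M *\<^sub>v x \<in> carrier_vec n" "M *\<^sub>v v \<in> carrier_vec n" "t \<cdot>\<^sub>v v \<in> carrier_vec n"
    "t \<cdot>\<^sub>v (M *\<^sub>v v) \<in> carrier_vec n"
    using M x v by auto
  have "M *\<^sub>v (x + t \<cdot>\<^sub>v v) = M *\<^sub>v x + t \<cdot>\<^sub>v (M *\<^sub>v v)"
    using mult_add_distrib_mat_vec[OF M x c(3)] mult_mat_vec[OF M v] by simp
  hence "(x + t \<cdot>\<^sub>v v) \<bullet> (M *\<^sub>v (x + t \<cdot>\<^sub>v v))
      = x \<bullet> (M *\<^sub>v x) + t * (x \<bullet> (M *\<^sub>v v)) + t * (v \<bullet> (M *\<^sub>v x)) + t * (t * (v \<bullet> (M *\<^sub>v v)))"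
    using x v c
    by (simp add: add_scalar_prod_distrib[of _ n] scalar_prod_add_distrib[of _ n]
        smult_scalar_prod_distrib[of _ n] scalar_prod_smult_distrib[of _ n]
        distrib_left del: scalar_prod_smult_left scalar_prod_smult_right)
  thus ?thesis
    using symmetric_scalar_prod_mult_mat_vec[OF M sym x v]
    by (simp add: power2_eq_square algebra_simps)
qed

text \<open>The constant \<open>c\<close> leaves room for the quadratic form of the other variable,
  which is frozen when a partial gradient of the Hamiltonian is taken. The formula for
  \<open>f\<close> is asked for on the carrier only, since the Hamiltonian is prescribed only
  there.\<close>

lemma grad_quadratic:
  fixes M :: "real mat"
  assumes M: "M \<in> carrier_mat n n" and sym: "M = M\<^sup>T" and x: "x \<in> carrier_vec n"
    and f: "\<And>x. x \<in> carrier_vec n \<Longrightarrow> f x = 1 / 2 * (x \<bullet> (M *\<^sub>v x)) + c"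
  shows "grad n f x = M *\<^sub>v x"
proof (rule eq_vecI)
  show "dim_vec (grad n f x) = dim_vec (M *\<^sub>v x)"
    using M by (simp add: grad_def)
next
  fix i assume "i < dim_vec (M *\<^sub>v x)"
  hence i: "i < n" using M by simp
  define v :: "real vec" where "v = unit_vec n i"
  have v: "v \<in> carrier_vec n" by (simp add: v_def)
  have "f (x + t \<cdot>\<^sub>v v)
      = 1 / 2 * (x \<bullet> (M *\<^sub>v x)) + t * (v \<bullet> (M *\<^sub>v x)) + t\<^sup>2 / 2 * (v \<bullet> (M *\<^sub>v v)) + c" for t
    using x v f[of "x + t \<cdot>\<^sub>v v"] quadratic_form_add_smult[OF M sym x v, of t] by simp
  \<comment> \<open>At \<open>t = 0\<close> the quadratic term contributes nothing to the
    derivative, and the linear coefficient remains.\<close>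
  hence "((\<lambda>t. f (x + t \<cdot>\<^sub>v v)) has_field_derivative v \<bullet> (M *\<^sub>v x)) (at 0)"
    by (auto intro!: derivative_eq_intros)
  hence "deriv (\<lambda>t. f (x + t \<cdot>\<^sub>v v)) 0 = v \<bullet> (M *\<^sub>v x)"
    by (rule DERIV_imp_deriv)
  also have "\<dots> = (M *\<^sub>v x) $ i"
    unfolding v_def using M x i by (intro scalar_prod_left_unit[of _ n]) auto
  finally show "grad n f x $ i = (M *\<^sub>v x) $ i"
    using i by (simp add: grad_def v_def)
qed

lemma midpoint_carrier_vec:
  assumes "\<And>k. z k \<in> carrier_vec n"
  shows "midpoint z k \<in> carrier_vec n"
  using assms by (simp add: midpoint_def)

text \<open>A discrete chain rule without remainder: the mixed terms of the old and the new value
  cancel by symmetry, and the factor 1/2 comes from the midpoint average.\<close>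

lemma quadratic_form_increment:
  fixes M :: "real mat"
  assumes M: "M \<in> carrier_mat n n" and sym: "M = M\<^sup>T" and z: "\<And>k. z k \<in> carrier_vec n"
  shows "(z (Suc k) - z k) \<bullet> (M *\<^sub>v midpoint z k)
    = 1 / 2 * (z (Suc k) \<bullet> (M *\<^sub>v z (Suc k))) - 1 / 2 * (z k \<bullet> (M *\<^sub>v z k))"
proof -
  let ?a = "z k" and ?b = "z (Suc k)"
  have c: "?a \<in> carrier_vec n" "?b \<in> carrier_vec n" "?a + ?b \<in> carrier_vec n"
    "M *\<^sub>v ?a \<in> carrier_vec n" "M *\<^sub>v ?b \<in> carrier_vec n"
    using M z[of k] z[of "Suc k"] by auto
  have "M *\<^sub>v midpoint z k = (1 / 2) \<cdot>\<^sub>v (M *\<^sub>v ?a + M *\<^sub>v ?b)"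
    using mult_mat_vec[OF M c(3)] mult_add_distrib_mat_vec[OF M c(1,2)]
    by (simp add: midpoint_def)
  hence "(?b - ?a) \<bullet> (M *\<^sub>v midpoint z k) = 1 / 2 * ((?b - ?a) \<bullet> (M *\<^sub>v ?a + M *\<^sub>v ?b))"
    using c by (simp add: scalar_prod_smult_distrib[of _ n] del: scalar_prod_smult_right)
  also have "(?b - ?a) \<bullet> (M *\<^sub>v ?a + M *\<^sub>v ?b)
      = ?b \<bullet> (M *\<^sub>v ?a) + ?b \<bullet> (M *\<^sub>v ?b) - (?a \<bullet> (M *\<^sub>v ?a) + ?a \<bullet> (M *\<^sub>v ?b))"
    using c by (simp add: minus_scalar_prod_distrib[of _ n] scalar_prod_add_distrib[of _ n])
  finally show ?thesis
    using symmetric_scalar_prod_mult_mat_vec[OF M sym c(2,1)] by (simp add: algebra_simps)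
qed

theorem theorem6:
  fixes n n1 n2 n3 m :: nat
    and J R B E M1 M2 :: "real mat"
    and e :: "real vec \<Rightarrow> real vec \<Rightarrow> real vec"
    and H :: "real vec \<Rightarrow> real vec \<Rightarrow> real"
    and \<tau> :: real
    and u :: "real \<Rightarrow> real vec"
    and z1 z2 z3 y :: "nat \<Rightarrow> real vec"
  assumes n: "n = n1 + n2 + n3"
    and J: "J \<in> carrier_mat n n" and R: "R \<in> carrier_mat n n"
    and B: "B \<in> carrier_mat n m" and E: "E \<in> carrier_mat n2 n2"
    and e: "continuous_map (prod_topology (vec_topology n1) (vec_topology n2))
              (vec_topology n2) (\<lambda>(x1, x2). e x1 x2)"
    and J_skew: "J = - J\<^sup>T"
    and R_sym: "R = R\<^sup>T" and R_psd: "positive_semidefinite n R"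
    and M1: "M1 \<in> carrier_mat n1 n1" and M1_sym: "M1 = M1\<^sup>T"
    and M2: "M2 \<in> carrier_mat n2 n2" and M2_sym: "M2 = M2\<^sup>T"
    and H: "\<And>x1 x2. x1 \<in> carrier_vec n1 \<Longrightarrow> x2 \<in> carrier_vec n2 \<Longrightarrow>
              H x1 x2 = 1 / 2 * (x1 \<bullet> (M1 *\<^sub>v x1)) + 1 / 2 * (x2 \<bullet> (M2 *\<^sub>v x2))"
    and E_e: "\<And>x1 x2. x1 \<in> carrier_vec n1 \<Longrightarrow> x2 \<in> carrier_vec n2 \<Longrightarrow>
              E\<^sup>T *\<^sub>v e x1 x2 = grad n2 (\<lambda>x. H x1 x) x2"
    and tau: "\<tau> > 0"
    and u: "\<And>t. t \<ge> 0 \<Longrightarrow> u t \<in> carrier_vec m"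
    and scheme: "midpoint_scheme n1 n2 n3 m J R B E e H \<tau> u z1 z2 z3 y"
  shows "(\<forall>k. H (z1 (Suc k)) (z2 (Suc k)) - H (z1 k) (z2 k)
                \<le> \<tau> * (y k \<bullet> input_mid \<tau> u k)) \<and>
         ((\<forall>t\<ge>0. u t = 0\<^sub>v m) \<longrightarrow>
            (\<forall>k. H (z1 (Suc k)) (z2 (Suc k)) \<le> H (z1 k) (z2 k)))"
proof -
  have z1: "z1 k \<in> carrier_vec n1" and z2: "z2 k \<in> carrier_vec n2"
    and z3: "z3 k \<in> carrier_vec n3" and y: "y k \<in> carrier_vec m" for k
    using scheme unfolding midpoint_scheme_def by auto
  \<comment> \<open>A continuous map sends the underlying space of its domain into that of its
    target; here this fixes the dimension of \<open>e x1 x2\<close>.\<close>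
  have e_carrier: "e x1 x2 \<in> carrier_vec n2"
    if "x1 \<in> carrier_vec n1" "x2 \<in> carrier_vec n2" for x1 x2
    using continuous_map_image_subset_topspace[OF e] that
    by (auto simp: topspace_vec_topology image_subset_iff)
  have dissipation: "H (z1 (Suc k)) (z2 (Suc k)) - H (z1 k) (z2 k) \<le> \<tau> * (y k \<bullet> input_mid \<tau> u k)"
    for k
  proof -
    define x1 x2 where "x1 = midpoint z1 k" and "x2 = midpoint z2 k"
    define a b where "a = z1 (Suc k) - z1 k" and "b = z2 (Suc k) - z2 k"
    define v where "v = input_mid \<tau> u k"
    \<comment> \<open>The vector to which the scheme applies \<open>J - R\<close>. Its first block
      is an increment, which stands for \<tau> times a derivative; hence the factor \<tau> in the
      other two blocks.\<close>
    define w where "w = a @\<^sub>v (\<tau> \<cdot>\<^sub>v e x1 x2) @\<^sub>v (\<tau> \<cdot>\<^sub>v midpoint z3 k)"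
    have x1: "x1 \<in> carrier_vec n1" and x2: "x2 \<in> carrier_vec n2"
      and x3: "midpoint z3 k \<in> carrier_vec n3"
      unfolding x1_def x2_def using z1 z2 z3 by (auto intro: midpoint_carrier_vec)
    have a: "a \<in> carrier_vec n1" and b: "b \<in> carrier_vec n2"
      using z1 z2 by (auto simp: a_def b_def)
    \<comment> \<open>The sampling time \<open>k * \<tau> + \<tau> / 2\<close> is non-negative, so
      the assumption on \<open>u\<close> covers it.\<close>
    have v: "v \<in> carrier_vec m" using u tau by (simp add: v_def input_mid_def)
    have p: "e x1 x2 \<in> carrier_vec n2" using x1 x2 by (rule e_carrier)
    have w: "w \<in> carrier_vec n"
      unfolding w_def n using a p x3 by (intro carrier_vecI) simp
    have g1: "grad n1 (\<lambda>x. H x x2) x1 = M1 *\<^sub>v x1"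
      using M1 M1_sym x1
      by (rule grad_quadratic[where c = "1 / 2 * (x2 \<bullet> (M2 *\<^sub>v x2))"]) (simp only: H x2)
    have g2: "grad n2 (\<lambda>x. H x1 x) x2 = M2 *\<^sub>v x2"
      using M2 M2_sym x2
      by (rule grad_quadratic[where c = "1 / 2 * (x1 \<bullet> (M1 *\<^sub>v x1))"]) (simp only: H x1 add.commute)
    \<comment> \<open>The state and output equations of step \<open>k\<close>, with the gradient in
      \<open>z1\<close> already evaluated by \<open>g1\<close>.\<close>
    have state: "(\<tau> \<cdot>\<^sub>v (M1 *\<^sub>v x1)) @\<^sub>v (E *\<^sub>v b) @\<^sub>v 0\<^sub>v n3 = (J - R) *\<^sub>v w + \<tau> \<cdot>\<^sub>v (B *\<^sub>v v)"
      and out: "\<tau> \<cdot>\<^sub>v y k = B\<^sup>T *\<^sub>v w"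
      using scheme[unfolded midpoint_scheme_def Let_def, THEN conjunct2, rule_format, of k]
      unfolding g1[symmetric] unfolding w_def a_def b_def v_def x1_def x2_def by (rule conjunct1, rule conjunct2)
    have c: "J *\<^sub>v w \<in> carrier_vec n" "R *\<^sub>v w \<in> carrier_vec n" "B *\<^sub>v v \<in> carrier_vec n"
      "E *\<^sub>v b \<in> carrier_vec n2" "M1 *\<^sub>v x1 \<in> carrier_vec n1"
      using J R B E M1 w v b x1 by auto
    have c_smult: "\<tau> \<cdot>\<^sub>v (M1 *\<^sub>v x1) \<in> carrier_vec n1" "\<tau> \<cdot>\<^sub>v e x1 x2 \<in> carrier_vec n2"
      "\<tau> \<cdot>\<^sub>v midpoint z3 k \<in> carrier_vec n3" "\<tau> \<cdot>\<^sub>v (B *\<^sub>v v) \<in> carrier_vec n"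
      "(J - R) *\<^sub>v w \<in> carrier_vec n"
      using c p x3 mult_mat_vec_carrier[OF minus_carrier_mat[OF R] w] by auto
    \<comment> \<open>The left side of the state equation is tested with \<open>w\<close> block by
      block; the zero third block removes \<open>z3\<close>.\<close>
    have "w \<bullet> ((\<tau> \<cdot>\<^sub>v (M1 *\<^sub>v x1)) @\<^sub>v (E *\<^sub>v b) @\<^sub>v 0\<^sub>v n3)
        = a \<bullet> (\<tau> \<cdot>\<^sub>v (M1 *\<^sub>v x1)) + ((\<tau> \<cdot>\<^sub>v e x1 x2) @\<^sub>v (\<tau> \<cdot>\<^sub>v midpoint z3 k)) \<bullet> ((E *\<^sub>v b) @\<^sub>v 0\<^sub>v n3)"
      unfolding w_def using a c_smult c(4)
      by (intro scalar_prod_append[of _ n1 _ "n2 + n3"] append_carrier_vec zero_carrier_vec)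
    also have "((\<tau> \<cdot>\<^sub>v e x1 x2) @\<^sub>v (\<tau> \<cdot>\<^sub>v midpoint z3 k)) \<bullet> ((E *\<^sub>v b) @\<^sub>v 0\<^sub>v n3)
        = (\<tau> \<cdot>\<^sub>v e x1 x2) \<bullet> (E *\<^sub>v b) + (\<tau> \<cdot>\<^sub>v midpoint z3 k) \<bullet> 0\<^sub>v n3"
      using c_smult c(4) by (intro scalar_prod_append[of _ n2 _ n3] zero_carrier_vec)
    also have "(\<tau> \<cdot>\<^sub>v midpoint z3 k) \<bullet> 0\<^sub>v n3 = 0"
      by (rule scalar_prod_right_zero[OF c_smult(3)])
    also have "(\<tau> \<cdot>\<^sub>v e x1 x2) \<bullet> (E *\<^sub>v b) = \<tau> * (e x1 x2 \<bullet> (E *\<^sub>v b))"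
      by (rule smult_scalar_prod_distrib[OF p c(4)])
    \<comment> \<open>\<open>E\<close> moves over to \<open>e\<close> as its transpose, where the
      relation between \<open>e\<close> and the gradient applies at the midpoint, exactly where the
      scheme evaluates \<open>e\<close>.\<close>
    also have "e x1 x2 \<bullet> (E *\<^sub>v b) = (M2 *\<^sub>v x2) \<bullet> b"
      using transpose_vec_mult_scalar[OF E b p] E_e[OF x1 x2] g2 by simp
    also have "\<dots> = b \<bullet> (M2 *\<^sub>v x2)"
      using M2 x2 b by (intro comm_scalar_prod[of _ n2]) auto
    also have "b \<bullet> (M2 *\<^sub>v x2)
        = 1 / 2 * (z2 (Suc k) \<bullet> (M2 *\<^sub>v z2 (Suc k))) - 1 / 2 * (z2 k \<bullet> (M2 *\<^sub>v z2 k))"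
      unfolding b_def x2_def using M2 M2_sym z2 by (rule quadratic_form_increment)
    also have "a \<bullet> (\<tau> \<cdot>\<^sub>v (M1 *\<^sub>v x1)) = \<tau> * (a \<bullet> (M1 *\<^sub>v x1))"
      by (rule scalar_prod_smult_distrib[OF a c(5)])
    also have "a \<bullet> (M1 *\<^sub>v x1)
        = 1 / 2 * (z1 (Suc k) \<bullet> (M1 *\<^sub>v z1 (Suc k))) - 1 / 2 * (z1 k \<bullet> (M1 *\<^sub>v z1 k))"
      unfolding a_def x1_def using M1 M1_sym z1 by (rule quadratic_form_increment)
    \<comment> \<open>Since the Hamiltonian splits into a part in \<open>z1\<close> and a part in
      \<open>z2\<close>, the two increments add up to its own increment.\<close>
    finally have lhs: "w \<bullet> ((\<tau> \<cdot>\<^sub>v (M1 *\<^sub>v x1)) @\<^sub>v (E *\<^sub>v b) @\<^sub>v 0\<^sub>v n3)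
        = \<tau> * (H (z1 (Suc k)) (z2 (Suc k)) - H (z1 k) (z2 k))"
      by (simp add: H[OF z1 z2] algebra_simps)
    \<comment> \<open>Now the right side of the state equation is tested with the same
      \<open>w\<close>.\<close>
    have "w \<bullet> ((J - R) *\<^sub>v w + \<tau> \<cdot>\<^sub>v (B *\<^sub>v v))
        = w \<bullet> ((J - R) *\<^sub>v w) + w \<bullet> (\<tau> \<cdot>\<^sub>v (B *\<^sub>v v))"
      by (rule scalar_prod_add_distrib[OF w c_smult(5,4)])
    also have "w \<bullet> ((J - R) *\<^sub>v w) = w \<bullet> (J *\<^sub>v w - R *\<^sub>v w)"
      using J R w by (simp only: minus_mult_distrib_mat_vec)
    also have "\<dots> = w \<bullet> (J *\<^sub>v w) - w \<bullet> (R *\<^sub>v w)"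
      by (rule scalar_prod_minus_distrib[OF w c(1,2)])
    also have "w \<bullet> (J *\<^sub>v w) = 0"
      using J J_skew w by (rule skew_symmetric_scalar_prod_mult_mat_vec)
    also have "w \<bullet> (\<tau> \<cdot>\<^sub>v (B *\<^sub>v v)) = \<tau> * (w \<bullet> (B *\<^sub>v v))"
      by (rule scalar_prod_smult_distrib[OF w c(3)])
    \<comment> \<open>The output equation identifies the transpose of \<open>B\<close> applied to
      \<open>w\<close> as \<tau> times the output; this is the second factor \<tau> of the supply
      term.\<close>
    also have "w \<bullet> (B *\<^sub>v v) = (\<tau> \<cdot>\<^sub>v y k) \<bullet> v"
      using transpose_vec_mult_scalar[OF B v w] out by simp
    also have "\<dots> = \<tau> * (y k \<bullet> v)"
      by (rule smult_scalar_prod_distrib[OF y v])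
    finally have rhs: "w \<bullet> ((J - R) *\<^sub>v w + \<tau> \<cdot>\<^sub>v (B *\<^sub>v v))
        = 0 - w \<bullet> (R *\<^sub>v w) + \<tau> * (\<tau> * (y k \<bullet> v))" .
    have "0 \<le> w \<bullet> (R *\<^sub>v w)"
      using R_psd w by (simp add: positive_semidefinite_def)
    \<comment> \<open>Dropping the non-negative dissipation term turns the exact balance into an
      inequality. One common factor \<tau> > 0 is then cancelled, and the other stays in the
      bound.\<close>
    hence "\<tau> * (H (z1 (Suc k)) (z2 (Suc k)) - H (z1 k) (z2 k)) \<le> \<tau> * (\<tau> * (y k \<bullet> v))"
      using lhs rhs state by simp
    thus ?thesis using tau by (simp add: v_def)
  qed
  have "H (z1 (Suc k)) (z2 (Suc k)) \<le> H (z1 k) (z2 k)" if "\<forall>t\<ge>0. u t = 0\<^sub>v m" for k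
  proof -
    have "input_mid \<tau> u k = 0\<^sub>v m" using that tau by (simp add: input_mid_def)
    thus ?thesis using dissipation[of k] y by simp
  qed
  with dissipation show ?thesis by blast
qed

end
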